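(* Let $p>13$ be a prime. There is no subgroup $H$ of the multiplicative group $\mathbb{F}_p^\times$ and no element $g\in\mathbb{F}_p^\times$ such that the coset $A=gH=\{gh\colon h\in H\}$ satisfies $A-A\doteq\mathcal{R}_p$.
   Context: $\mathbb{F}_p$ is the field with $p$ elements and $\mathcal{R}_p\subseteq\mathbb{F}_p$ denotes the set of nonzero quadratic residues modulo $p$. For subsets $A,S$ of an abelian group, $A-A\doteq S$ means: every element of $S$ has exactly one representation as $a'-a''$ with $a',a''\in A$, and every difference $a'-a''$ with $a',a''\in A$, $a'\ne a''$, belongs to $S$. *)

theory Defs
  imports "HOL-Number_Theory.Number_Theory" "HOL-Algebra.Multiplicative_Group"
begin

text \<open>F_p is modelled by the HOL-Algebra ring residue_ring p (carrier {0..p-1}),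
  and the multiplicative group F_p^x by mult_of (residue_ring p).\<close>

definition QR_set :: "int \<Rightarrow> int set" where
  "QR_set p = {x \<in> carrier (residue_ring p). x \<noteq> \<zero>\<^bsub>residue_ring p\<^esub> \<and>
      (\<exists>y \<in> carrier (residue_ring p). y \<otimes>\<^bsub>residue_ring p\<^esub> y = x)}"

definition diff_exact :: "('a, 'b) ring_scheme \<Rightarrow> 'a set \<Rightarrow> 'a set \<Rightarrow> bool" where
  "diff_exact R A S \<longleftrightarrow>
     (\<forall>s \<in> S. \<exists>!ab. fst ab \<in> A \<and> snd ab \<in> A \<and> fst ab \<ominus>\<^bsub>R\<^esub> snd ab = s) \<and>
     (\<forall>a1 \<in> A. \<forall>a2 \<in> A. a1 \<noteq> a2 \<longrightarrow> a1 \<ominus>\<^bsub>R\<^esub> a2 \<in> S)"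

end

theory Submission
  imports Defs
begin

text \<open>
  Put n = |H|, so that p = 2n(n - 1) + 1 and n > 3; let chi be the quadratic character and
  e = chi(g). If n were even, -1 would lie in H and h - 1 = (-1) - (-h) would be represented
  twice; so n is odd. For h in H other than 1 we have chi(h - 1) = e, and h^2 is again different
  from 1, so h^2 - 1 = (h - 1)(h + 1) gives chi(h + 1) = 1. With D = (p - 1)/2 + n - 1 = n^2 - 1,
  Stepanov's polynomial F(x) = (1/n) (SUM h in H. h (x - h)^D) has degree n(n - 1), and F - e
  vanishes on H to order n - 1. Hence F = e + K (x^n - 1)^(n - 1), and comparing constant terms
  K = 1 - e. Evaluating F'(-1) from this formula and from the values chi(h + 1) gives
  n^2 K = (n + 1)(chi(2) - 1) mod p. If chi(2) = 1, then K, a binomial coefficient with upper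
  index D < p, would vanish mod p. If chi(2) = -1, then p divides 2(n + 1) or n^2 + n + 1,
  both impossible for n > 3. Below, F is represented only by its coefficients w l at x^(n l).
\<close>

section \<open>Residues modulo a prime\<close>

lemma fermat_int:
  fixes a :: int
  assumes "prime p" "\<not> int p dvd a"
  shows "[a ^ (p - 1) = 1] (mod int p)"
proof -
  interpret residues_prime p "residue_ring (int p)" by unfold_locales (use assms in auto)
  have "[a ^ totient (nat (int p)) = 1] (mod int p)"
    by (rule euler_theorem) (use assms(2) p_coprime_right_int in blast)
  thus ?thesis using assms(1) by (simp add: totient_prime)
qed

lemma square_eq_one_mod_prime:
  fixes a :: int
  assumes "prime p" "[a * a = 1] (mod int p)"
  shows "[a = 1] (mod int p) \<or> [a = -1] (mod int p)"
proof -
  have "int p dvd (a - 1) * (a + 1)" using assms(2) by (simp add: cong_iff_dvd_diff algebra_simps)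
  thus ?thesis using assms(1) by (auto simp: prime_dvd_mult_iff cong_iff_dvd_diff)
qed

lemma cong_int_range_eq:
  fixes x y :: int
  assumes "[x = y] (mod m)" "x \<in> {0..<m}" "y \<in> {0..<m}"
  shows "x = y"
  using assms by (simp add: cong_def)

lemma cong_cancel_range:
  fixes a x y :: int
  assumes "prime p" "[a * x = a * y] (mod int p)" "\<not> int p dvd a"
    and "x \<in> {0..<int p}" "y \<in> {0..<int p}"
  shows "x = y"
proof -
  have "int p dvd a * (x - y)" using assms(2) by (simp add: cong_iff_dvd_diff algebra_simps)
  hence "[x = y] (mod int p)" using assms(1,3) by (auto simp: prime_dvd_mult_iff cong_iff_dvd_diff)
  thus ?thesis using assms(4,5) by (rule cong_int_range_eq)
qed

lemma range_not_dvd: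
  fixes x m :: int
  assumes "x \<in> {1..<m}"
  shows "\<not> m dvd x"
  using assms by (auto dest: zdvd_imp_le)

section \<open>Subgroups of F_p^x as sets of integer representatives, and their power sums\<close>

locale residue_subgroup =
  fixes p :: nat and H :: "int set"
  assumes prime: "prime p"
    and sub: "H \<subseteq> {1..<int p}"
    and one: "1 \<in> H"
    and mult: "x \<in> H \<Longrightarrow> y \<in> H \<Longrightarrow> x * y mod int p \<in> H"
begin

lemma fin: "finite H"
  using sub finite_subset by blast

lemma card_pos: "card H > 0"
  using fin one by (auto simp: card_gt_0_iff)

lemma range: "x \<in> H \<Longrightarrow> x \<in> {0..<int p}" "x \<in> H \<Longrightarrow> \<not> int p dvd x"
  using sub range_not_dvd[of x "int p"] by (auto simp: subset_iff)

lemma bij_mult: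
  assumes "h \<in> H"
  shows "bij_betw (\<lambda>x. h * x mod int p) H H"
proof -
  have inj: "inj_on (\<lambda>x. h * x mod int p) H"
  proof (rule inj_onI)
    fix x y assume *: "x \<in> H" "y \<in> H" "h * x mod int p = h * y mod int p"
    show "x = y"
      by (rule cong_cancel_range[OF prime, of h]) (use * assms range in \<open>auto simp: cong_def\<close>)
  qed
  moreover have "(\<lambda>x. h * x mod int p) ` H \<subseteq> H" using mult assms by auto
  ultimately show ?thesis using endo_inj_surj[OF fin] by (auto simp: bij_betw_def)
qed

text \<open>Multiplication by \<open>h\<close> permutes \<open>H\<close>, so the product of all
  elements of \<open>H\<close> reappears with an extra factor \<open>h ^ card H\<close>; that
  product is a unit and cancels.\<close>

lemma power_card:
  assumes "h \<in> H"
  shows "[h ^ card H = 1] (mod int p)"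
proof -
  have "(\<Prod>x\<in>H. x) = (\<Prod>x\<in>H. h * x mod int p)"
    by (rule prod.reindex_bij_betw[OF bij_mult[OF assms], symmetric])
  also have "[\<dots> = (\<Prod>x\<in>H. h * x)] (mod int p)"
    by (rule cong_prod) (simp add: cong_def)
  also have "(\<Prod>x\<in>H. h * x) = h ^ card H * (\<Prod>x\<in>H. x)"
    by (simp add: prod.distrib)
  finally have "int p dvd (\<Prod>x\<in>H. x) * (h ^ card H - 1)"
    by (simp add: cong_iff_dvd_diff dvd_diff_commute algebra_simps)
  moreover have "\<not> int p dvd (\<Prod>x\<in>H. x)"
    using range fin prime by (auto simp: prime_dvd_prod_iff)
  ultimately show ?thesis
    using prime by (auto simp: prime_dvd_mult_iff cong_iff_dvd_diff)
qed

text \<open>Otherwise every element of \<open>H\<close> is a root of x^d = 1 with d = gcd(k, |H|).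
  Modulo p there are at most d such roots, so d = |H|. This root count stands in for the cyclicity
  of \<open>H\<close>.\<close>

lemma exists_power_neq_one:
  assumes "\<not> card H dvd k"
  shows "\<exists>h\<in>H. \<not> [h ^ k = 1] (mod int p)"
proof (rule ccontr)
  assume "\<not> ?thesis"
  hence k: "[h ^ k = 1] (mod int p)" if "h \<in> H" for h using that by blast
  define d where "d = gcd k (card H)"
  have d: "d > 0" using card_pos by (simp add: d_def)
  have "H \<subseteq> int ` {x \<in> {..<p}. [x ^ d = 1] (mod p)}"
  proof
    fix h assume h: "h \<in> H"
    define a where "a = nat h"
    have a: "h = int a" using range(1)[OF h] by (simp add: a_def)
    have "[a ^ k = 1] (mod p)" "[a ^ card H = 1] (mod p)"
      using k[OF h] power_card[OF h] unfolding a by (simp_all flip: cong_int_iff)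
    hence "[a ^ d = 1] (mod p)" by (simp only: ord_divides d_def gcd_greatest)
    thus "h \<in> int ` {x \<in> {..<p}. [x ^ d = 1] (mod p)}"
      using range(1)[OF h] a by auto
  qed
  hence "card H \<le> card (int ` {x \<in> {..<p}. [x ^ d = 1] (mod p)})"
    by (intro card_mono) auto
  also have "\<dots> \<le> card {x \<in> {..<p}. [x ^ d = 1] (mod p)}" by (rule card_image_le) simp
  also have "\<dots> \<le> d" by (rule roots_mod_prime_bound) (use prime d in auto)
  finally have "d = card H" using card_pos by (simp add: d_def dvd_imp_le le_antisym)
  thus False using assms by (metis d_def gcd_dvd1)
qed

text \<open>Translation by an \<open>h\<close> with \<open>h ^ k\<close> different from 1 fixes the
  sum and also scales it by \<open>h ^ k\<close>. These values are what make F a polynomial in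
  x^n.\<close>

lemma power_sum:
  "[(\<Sum>h\<in>H. h ^ k) = (if card H dvd k then int (card H) else 0)] (mod int p)"
proof (cases "card H dvd k")
  case True
  then obtain q where q: "k = card H * q" by auto
  have "[(\<Sum>h\<in>H. h ^ k) = (\<Sum>h\<in>H. 1)] (mod int p)"
  proof (rule cong_sum)
    fix h assume "h \<in> H"
    from cong_pow[OF power_card[OF this], of q] show "[h ^ k = 1] (mod int p)"
      by (simp add: q power_mult)
  qed
  thus ?thesis using True by simp
next
  case False
  then obtain h where h: "h \<in> H" "\<not> [h ^ k = 1] (mod int p)" using exists_power_neq_one by blast
  have "(\<Sum>x\<in>H. x ^ k) = (\<Sum>x\<in>H. (h * x mod int p) ^ k)"
    by (rule sum.reindex_bij_betw[OF bij_mult[OF h(1)], symmetric])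
  also have "[\<dots> = (\<Sum>x\<in>H. (h * x) ^ k)] (mod int p)"
    by (intro cong_sum cong_pow) (simp add: cong_def)
  also have "(\<Sum>x\<in>H. (h * x) ^ k) = h ^ k * (\<Sum>x\<in>H. x ^ k)"
    by (simp add: power_mult_distrib sum_distrib_left)
  finally have "int p dvd (h ^ k - 1) * (\<Sum>x\<in>H. x ^ k)"
    by (simp add: cong_iff_dvd_diff dvd_diff_commute algebra_simps)
  thus ?thesis using False h(2) prime by (auto simp: prime_dvd_mult_iff cong_iff_dvd_diff)
qed

lemma power_mem: "h \<in> H \<Longrightarrow> h ^ k mod int p \<in> H"
proof (induction k)
  case 0
  thus ?case using one range(1)[OF one] by simp
next
  case (Suc k)
  thus ?case using mult[of h "h ^ k mod int p"] by (simp add: mod_mult_right_eq)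
qed

text \<open>Half the order is not a multiple of the order, so some \<open>h\<close> has a power
  h^(n/2) that is not 1 but has square 1.\<close>

lemma minus_one_mem:
  assumes "even (card H)"
  shows "int p - 1 \<in> H"
proof -
  define k where "k = card H div 2"
  have k: "card H = k + k" using assms by (auto simp: k_def elim!: evenE)
  have "\<not> card H dvd k" using k card_pos by (auto dest: dvd_imp_le)
  then obtain h where h: "h \<in> H" "\<not> [h ^ k = 1] (mod int p)" using exists_power_neq_one by blast
  have "[h ^ k * h ^ k = 1] (mod int p)"
    using power_card[OF h(1)] by (simp add: k power_add)
  with h(2) have "[h ^ k = -1] (mod int p)" using square_eq_one_mod_prime[OF prime] by blast
  hence "h ^ k mod int p = (-1) mod int p" by (simp add: cong_def)
  also have "\<dots> = int p - 1" using prime_gt_1_nat[OF prime] by (simp add: zmod_minus1)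
  finally show ?thesis using power_mem[OF h(1), of k] by simp
qed

end

section \<open>Quadratic residues and the counting of differences\<close>

lemma QR_set_eq:
  "QR_set (int p) = {x \<in> {1..<int p}. \<exists>y\<in>{0..<int p}. y * y mod int p = x}"
proof -
  have "{0..int p - 1} = {0..<int p}" by auto
  moreover have "(x \<in> {0..<int p} \<and> x \<noteq> 0) \<longleftrightarrow> x \<in> {1..<int p}" for x by auto
  ultimately show ?thesis
    by (simp add: QR_set_def residue_ring_def flip: conj_assoc)
qed

text \<open>Since y and p - y have the same square, the half system 1, ..., m yields all nonzero
  squares, each exactly once.\<close>

lemma card_QR_set:
  assumes "prime p" "odd p"
  shows "card (QR_set (int p)) = (p - 1) div 2"
proof -
  define m where "m = (p - 1) div 2"
  have pm: "p = 2 * m + 1" using assms(2) by (auto elim!: oddE simp: m_def)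
  have "QR_set (int p) = (\<lambda>y. y * y mod int p) ` {1..int m}"
  proof (intro equalityI subsetI)
    fix x assume "x \<in> QR_set (int p)"
    then obtain y where y: "x \<noteq> 0" "y \<in> {0..<int p}" "y * y mod int p = x"
      by (auto simp: QR_set_eq)
    hence "y \<noteq> 0" by auto
    show "x \<in> (\<lambda>y. y * y mod int p) ` {1..int m}"
    proof (cases "y \<le> int m")
      case True
      thus ?thesis using y \<open>y \<noteq> 0\<close> by (intro image_eqI[of _ _ y]) auto
    next
      case False
      have "(int p - y) * (int p - y) = y * y + int p * (int p - 2 * y)" by (simp add: algebra_simps)
      hence "(int p - y) * (int p - y) mod int p = x" using y by simp
      thus ?thesis using y False pm by (intro image_eqI[of _ _ "int p - y"]) auto
    qed
  next
    fix x assume "x \<in> (\<lambda>y. y * y mod int p) ` {1..int m}"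
    then obtain y where y: "y \<in> {1..int m}" "x = y * y mod int p" by auto
    have "\<not> int p dvd y" by (rule range_not_dvd) (use y pm in auto)
    hence "\<not> int p dvd y * y" using assms(1) by (simp add: prime_dvd_mult_iff)
    hence "x \<noteq> 0" using y by (simp add: dvd_eq_mod_eq_0)
    moreover have "0 \<le> x" "x < int p" using y(2) pm by simp_all
    ultimately have "x \<in> {1..<int p}" by simp
    moreover have "y \<in> {0..<int p}" using y(1) pm by simp
    ultimately show "x \<in> QR_set (int p)"
      unfolding QR_set_eq using y(2) by blast
  qed
  moreover have "inj_on (\<lambda>y. y * y mod int p) {1..int m}"
  proof (rule inj_onI)
    fix y z assume yz: "y \<in> {1..int m}" "z \<in> {1..int m}" "y * y mod int p = z * z mod int p"
    hence "int p dvd (y - z) * (y + z)"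
      by (simp add: mod_eq_dvd_iff algebra_simps)
    moreover have "\<not> int p dvd y + z" by (rule range_not_dvd) (use yz pm in auto)
    ultimately have "[y = z] (mod int p)"
      using assms(1) by (auto simp: prime_dvd_mult_iff cong_iff_dvd_diff)
    thus "y = z" by (rule cong_int_range_eq) (use yz pm in auto)
  qed
  ultimately show ?thesis by (simp add: card_image m_def)
qed

text \<open>The easy direction of Euler's criterion: Fermat's theorem for a square root
  \<open>y\<close>. Here \<open>x\<close> is an unreduced integer, so that it can be a product
  \<open>g * (h - 1)\<close>.\<close>

lemma QR_set_power:
  assumes "prime p" "odd p" "x mod int p \<in> QR_set (int p)"
  shows "[x ^ ((p - 1) div 2) = 1] (mod int p)"
proof -
  obtain y where y: "x mod int p \<noteq> 0" "y * y mod int p = x mod int p"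
    using assms(3) by (auto simp: QR_set_eq)
  have "\<not> int p dvd y" using y by auto
  have "[x ^ ((p - 1) div 2) = (y * y) ^ ((p - 1) div 2)] (mod int p)"
    by (rule cong_pow) (use y in \<open>simp add: cong_def\<close>)
  also have "(y * y) ^ ((p - 1) div 2) = y ^ (p - 1)"
    using assms(2) by (simp add: power_mult_distrib mult_2[symmetric] flip: power_add)
  also have "[y ^ (p - 1) = 1] (mod int p)" by (rule fermat_int) fact+
  finally show ?thesis .
qed

lemma residue_ring_minus:
  assumes "prime p"
  shows "a \<ominus>\<^bsub>residue_ring (int p)\<^esub> b = (a - b) mod int p"
proof -
  interpret residues_prime p "residue_ring (int p)" by unfold_locales (use assms in auto)
  show ?thesis
    by (simp add: a_minus_def res_add_eq res_neg_eq mod_add_right_eq)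
qed

text \<open>Subtraction maps the ordered pairs of distinct elements of \<open>A\<close> bijectively
  onto \<open>S\<close>; as 0 is outside \<open>S\<close>, no representing pair lies on the
  diagonal. For the quadratic residues this gives n(n - 1) = (p - 1)/2.\<close>

lemma diff_exact_card:
  assumes "prime p" "A \<subseteq> {0..<int p}" "0 \<notin> S"
    and ex: "diff_exact (residue_ring (int p)) A S"
  shows "card A * (card A - 1) = card S"
proof -
  let ?P = "A \<times> A - (\<lambda>a. (a, a)) ` A"
  let ?d = "\<lambda>ab. (fst ab - snd ab) mod int p"
  have finA: "finite A" using assms(2) finite_subset by blast
  note ex' = ex[unfolded diff_exact_def residue_ring_minus[OF assms(1)]]
  have "bij_betw ?d ?P S"
    unfolding bij_betw_def
  proof (intro conjI inj_onI equalityI subsetI)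
    fix u v assume *: "u \<in> ?P" "v \<in> ?P" "?d u = ?d v"
    have A: "fst u \<in> A" "snd u \<in> A" "fst v \<in> A" "snd v \<in> A" "fst u \<noteq> snd u"
      using *(1,2) by (auto simp: image_iff)
    hence "?d u \<in> S" using ex' by blast
    hence "\<exists>!ab. fst ab \<in> A \<and> snd ab \<in> A \<and> ?d ab = ?d u" using ex' by blast
    thus "u = v" using A *(3) by (elim ex1E) metis
  next
    fix s assume "s \<in> ?d ` ?P"
    then obtain u where u: "u \<in> ?P" "s = ?d u" by blast
    hence "fst u \<in> A" "snd u \<in> A" "fst u \<noteq> snd u" by (auto simp: image_iff)
    thus "s \<in> S" using ex' u(2) by blast
  next
    fix s assume s: "s \<in> S"
    then obtain u where u: "fst u \<in> A" "snd u \<in> A" "?d u = s" using ex' by blast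
    have "fst u \<noteq> snd u" using u s assms(3) by auto
    thus "s \<in> ?d ` ?P" using u by (intro image_eqI[of _ _ u]) (auto simp: mem_Times_iff)
  qed
  hence "card ?P = card S" by (rule bij_betw_same_card)
  moreover have "card ?P = card A * card A - card A"
    using finA by (subst card_Diff_subset) (auto simp: card_cartesian_product card_image inj_on_def)
  ultimately show ?thesis by (simp add: diff_mult_distrib2)
qed

section \<open>Interpolation and binomial coefficients modulo a prime\<close>

text \<open>Both sides are D! / ((D - m)! (m - k)!) for k \<le> m and vanish for k > m. The identity
  translates derivatives of F at 1 into falling factorial moments of its coefficients.\<close>

lemma choose_mult_falling:
  assumes "m \<le> D" "k \<le> D"
  shows "(\<Prod>i<k. int D - int i) * int ((D - k) choose (D - m))
       = int (D choose m) * (\<Prod>i<k. int m - int i)"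
  using assms(2)
proof (induction k)
  case 0
  show ?case using assms(1) binomial_symmetric[of m D] by simp
next
  case (Suc k)
  have "(int D - int k) * int ((D - Suc k) choose (D - m))
      = (int m - int k) * int ((D - k) choose (D - m))"
  proof (cases "k \<le> m")
    case True
    have "D - k - (D - m) = m - k" "D - k - 1 = D - Suc k" using True assms(1) by auto
    hence "(m - k) * ((D - k) choose (D - m)) = (D - k) * ((D - Suc k) choose (D - m))"
      using binomial_absorb_comp[of "D - k" "D - m"] by simp
    hence "int (m - k) * int ((D - k) choose (D - m)) = int (D - k) * int ((D - Suc k) choose (D - m))"
      by (metis of_nat_mult)
    thus ?thesis using True Suc.prems by (simp add: of_nat_diff)
  next
    case False
    thus ?thesis using Suc.prems by (simp add: binomial_eq_0)
  qed
  note step = this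
  have IH: "(\<Prod>i<k. int D - int i) * int ((D - k) choose (D - m))
       = int (D choose m) * (\<Prod>i<k. int m - int i)" using Suc by simp
  have "(\<Prod>i<Suc k. int D - int i) * int ((D - Suc k) choose (D - m))
      = (\<Prod>i<k. int D - int i) * ((int D - int k) * int ((D - Suc k) choose (D - m)))"
    by (simp add: mult.assoc)
  also have "\<dots> = (int m - int k) * ((\<Prod>i<k. int D - int i) * int ((D - k) choose (D - m)))"
    unfolding step by (simp only: mult_ac)
  also have "\<dots> = int (D choose m) * (\<Prod>i<Suc k. int m - int i)"
    unfolding IH by (simp add: mult_ac)
  finally show ?case .
qed

text \<open>Writing x - c = (x - k) + (k - c), a linear factor times the falling factorial of degree
  k is a combination of those of degrees k + 1 and k. Vanishing moments thus pass to the product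
  polynomials of Lagrange interpolation.\<close>

lemma sum_mult_prod_cong_0:
  fixes w x :: "'a \<Rightarrow> int" and c :: "'b \<Rightarrow> int"
  assumes fall: "\<And>k. 1 \<le> k \<Longrightarrow> k \<le> N \<Longrightarrow> [(\<Sum>l\<in>L. w l * (\<Prod>i<k. x l - int i)) = 0] (mod m)"
    and "finite J" "1 \<le> k" "k + card J \<le> N"
  shows "[(\<Sum>l\<in>L. w l * (\<Prod>i<k. x l - int i) * (\<Prod>j\<in>J. x l - c j)) = 0] (mod m)"
  using assms(2-)
proof (induction J arbitrary: k rule: finite_induct)
  case empty
  thus ?case using fall by simp
next
  case (insert j J)
  let ?f = "\<lambda>k l. w l * (\<Prod>i<k. x l - int i) * (\<Prod>j\<in>J. x l - c j)"
  have "(\<Sum>l\<in>L. w l * (\<Prod>i<k. x l - int i) * (\<Prod>j\<in>insert j J. x l - c j))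
      = (\<Sum>l\<in>L. ?f (Suc k) l) + (int k - c j) * (\<Sum>l\<in>L. ?f k l)"
    using insert.hyps by (simp add: sum_distrib_left flip: sum.distrib) (simp add: algebra_simps)
  moreover have "[(\<Sum>l\<in>L. ?f (Suc k) l) = 0] (mod m)" "[(\<Sum>l\<in>L. ?f k l) = 0] (mod m)"
    using insert.IH[of "Suc k"] insert.IH[of k] insert.prems insert.hyps by auto
  ultimately show ?case by (simp add: cong_0_iff)
qed

text \<open>The Lagrange denominator at m for the nodes 0, ..., N: node 0 gives
  \<open>int m\<close>, the other nodes below m give (m - 1)!, and those above give the sign and (N
  - m)!.\<close>

lemma prod_node_differences:
  assumes "1 \<le> m" "m \<le> N"
  shows "int m * (\<Prod>j\<in>{1..N} - {m}. int m - int j) = (-1) ^ (N - m) * (fact m * fact (N - m))"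
proof -
  have eq: "{1..N} - {m} = {1..<m} \<union> {Suc m..N}" using assms by auto
  have "(\<Prod>j\<in>{1..<m}. int m - int j) = (\<Prod>j\<in>{1..<m}. int j)"
    by (rule prod.reindex_bij_witness[of _ "\<lambda>j. m - j" "\<lambda>j. m - j"]) auto
  hence 1: "int m * (\<Prod>j\<in>{1..<m}. int m - int j) = fact m"
    using assms by (cases m) (simp_all add: fact_prod atLeastLessThanSuc_atLeastAtMost algebra_simps)
  have "(\<Prod>j\<in>{Suc m..N}. int m - int j) = (\<Prod>j\<in>{1..N-m}. - int j)"
    by (rule prod.reindex_bij_witness[of _ "\<lambda>j. j + m" "\<lambda>j. j - m"]) auto
  also have "\<dots> = (-1) ^ (N - m) * fact (N - m)"
    by (simp add: prod_uminus fact_prod)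
  finally have 2: "(\<Prod>j\<in>{Suc m..N}. int m - int j) = (-1) ^ (N - m) * fact (N - m)" .
  have "(\<Prod>j\<in>{1..N} - {m}. int m - int j)
      = (\<Prod>j\<in>{1..<m}. int m - int j) * (\<Prod>j\<in>{Suc m..N}. int m - int j)"
    unfolding eq by (rule prod.union_disjoint) auto
  thus ?thesis using 1 2 by (metis (no_types, lifting) mult.assoc mult.left_commute)
qed

text \<open>The same polynomial evaluated at N + 1. The last factor restores the omitted node m,
  which yields a factorial without division.\<close>

lemma prod_top_node_differences:
  assumes "1 \<le> m" "m \<le> N"
  shows "int (Suc N) * (\<Prod>j\<in>{1..N} - {m}. int (Suc N) - int j) * int (Suc N - m) = fact (Suc N)"
proof -
  have "(\<Prod>j\<in>{1..N}. int (Suc N) - int j) = (\<Prod>j\<in>{1..N}. int j)"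
    by (rule prod.reindex_bij_witness[of _ "\<lambda>j. Suc N - j" "\<lambda>j. Suc N - j"]) auto
  also have "\<dots> = fact N" by (simp add: fact_prod)
  finally have "(\<Prod>j\<in>{1..N}. int (Suc N) - int j) = fact N" .
  moreover have "(\<Prod>j\<in>{1..N}. int (Suc N) - int j)
     = (int (Suc N) - int m) * (\<Prod>j\<in>{1..N}-{m}. int (Suc N) - int j)"
    using assms by (intro prod.remove) auto
  moreover have "int (Suc N) - int m = int (Suc N - m)" using assms by auto
  ultimately have "int (Suc N - m) * (\<Prod>j\<in>{1..N} - {m}. int (Suc N) - int j) = fact N"
    by metis
  thus ?thesis by (simp only: fact_Suc mult_ac)
qed

lemma coprime_prime_int:
  assumes "prime p" "0 < m" "m < p"
  shows "coprime (int m) (int p)"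
  using assms by (metis coprime_commute coprime_int_iff nat_dvd_not_less prime_imp_coprime)

lemma coprime_prime_fact:
  assumes "prime p" "m < p"
  shows "coprime (fact m :: int) (int p)"
  using assms
  by (metis coprime_commute coprime_int_iff of_nat_fact prime_dvd_fact_iff prime_imp_coprime not_less)

text \<open>Lagrange interpolation at the nodes 1, ..., N + 1: the node 0 contributes
  nothing, and the product over J kills every node except m and N + 1.\<close>

lemma falling_moments_binomial:
  fixes w :: "nat \<Rightarrow> int"
  assumes p: "prime p" "0 < c" "c < p" "Suc N < p"
    and fall: "\<And>k. 1 \<le> k \<Longrightarrow> k \<le> N \<Longrightarrow>
      [(\<Sum>l\<le>Suc N. w l * (\<Prod>i<k. int (c * l) - int i)) = 0] (mod int p)"
    and m: "1 \<le> m" "m \<le> N"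
  shows "[w m = (-1) ^ (Suc N - m) * int (Suc N choose m) * w (Suc N)] (mod int p)"
proof -
  define J where "J = {1..N} - {m}"
  have fin: "finite J" by (simp add: J_def)
  have cJ: "card J = N - 1" using m by (simp add: J_def)
  let ?f = "\<lambda>l. w l * (\<Prod>i<1. int (c * l) - int i) * (\<Prod>j\<in>J. int (c * l) - int (c * j))"
  let ?g = "\<lambda>l. w l * (int l * (\<Prod>j\<in>J. int l - int j))"
  \<comment> \<open>One factor \<open>c\<close> comes from each of the 1 + (N - 1) linear factors;
    being a unit, it cancels later.\<close>
  have fg: "?f l = int c ^ N * ?g l" for l
  proof -
    have "(\<Prod>j\<in>J. int (c * l) - int (c * j)) = (\<Prod>j\<in>J. int c * (int l - int j))"
      by (simp add: algebra_simps)
    also have "\<dots> = int c ^ (N - 1) * (\<Prod>j\<in>J. int l - int j)"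
      by (simp add: prod.distrib cJ)
    finally show ?thesis using m by (cases N) (simp_all add: algebra_simps)
  qed
  have "[(\<Sum>l\<le>Suc N. ?f l) = 0] (mod int p)"
    by (rule sum_mult_prod_cong_0[where N = N]) (use fall fin cJ m in auto)
  also have "(\<Sum>l\<le>Suc N. ?f l) = int c ^ N * (\<Sum>l\<le>Suc N. ?g l)"
    by (simp only: fg sum_distrib_left)
  also have "(\<Sum>l\<le>Suc N. ?g l) = (\<Sum>l\<in>{m, Suc N}. ?g l)"
  proof (rule sum.mono_neutral_right)
    show "\<forall>l\<in>{..Suc N} - {m, Suc N}. ?g l = 0"
    proof
      fix l assume l: "l \<in> {..Suc N} - {m, Suc N}"
      show "?g l = 0"
      proof (cases "l = 0")
        case False
        hence "l \<in> J" using l by (auto simp: J_def)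
        hence "(\<Prod>j\<in>J. int l - int j) = 0" using fin by (intro prod_zero) auto
        thus ?thesis by simp
      qed simp
    qed
  qed (use m in auto)
  also have "\<dots> = ?g m + ?g (Suc N)" using m by simp
  finally have "[int c ^ N * (?g m + ?g (Suc N)) = int c ^ N * 0] (mod int p)" by simp
  moreover have "coprime (int c ^ N) (int p)" using coprime_prime_int[OF p(1-3)] by simp
  ultimately have 0: "[?g m + ?g (Suc N) = 0] (mod int p)"
    using cong_mult_lcancel by blast
  \<comment> \<open>The factor N + 1 - m turns both terms into multiples of m! (N + 1 - m)!, a unit
    because N + 1 < p.\<close>
  have "[(?g m + ?g (Suc N)) * int (Suc N - m) = 0 * int (Suc N - m)] (mod int p)"
    by (rule cong_scalar_right[OF 0])
  also have "(?g m + ?g (Suc N)) * int (Suc N - m)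
     = w m * ((-1) ^ (N - m) * (fact m * fact (N - m))) * int (Suc N - m) + w (Suc N) * fact (Suc N)"
    unfolding J_def prod_node_differences[OF m, symmetric] prod_top_node_differences[OF m, symmetric]
    by (simp only: algebra_simps)
  also have "fact (Suc N) = fact m * fact (Suc N - m) * int (Suc N choose m)"
    using binomial_fact_lemma[of m "Suc N"] m
    by (metis le_SucI of_nat_fact of_nat_mult)
  also have "w m * ((-1) ^ (N - m) * (fact m * fact (N - m))) * int (Suc N - m)
     = w m * (-1) ^ (N - m) * fact m * fact (Suc N - m)"
    using m by (simp add: Suc_diff_le algebra_simps)
  finally have "[(fact m * fact (Suc N - m)) * (w m * (-1) ^ (N - m) + w (Suc N) * int (Suc N choose m))
      = (fact m * fact (Suc N - m)) * 0] (mod int p)"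
    by (simp add: algebra_simps)
  moreover have "coprime (fact m * fact (Suc N - m) :: int) (int p)"
    using coprime_prime_fact[OF p(1), of m] coprime_prime_fact[OF p(1), of "Suc N - m"] p m by simp
  ultimately have 1: "[w m * (-1) ^ (N - m) + w (Suc N) * int (Suc N choose m) = 0] (mod int p)"
    using cong_mult_lcancel by blast
  have "[(-1) ^ (N - m) * (w m * (-1) ^ (N - m) + w (Suc N) * int (Suc N choose m)) = (-1) ^ (N - m) * 0] (mod int p)"
    by (rule cong_scalar_left[OF 1])
  also have "(-1) ^ (N - m) * (w m * (-1) ^ (N - m) + w (Suc N) * int (Suc N choose m))
    = w m * ((-1) ^ (N - m) * (-1) ^ (N - m)) - (-1) ^ (Suc N - m) * int (Suc N choose m) * w (Suc N)"
    using m by (simp add: Suc_diff_le algebra_simps)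
  also have "((-1) ^ (N - m) * (-1) ^ (N - m) :: int) = 1"
    by (metis minus_one_mult_self)
  finally show ?thesis by (simp add: cong_diff_iff_cong_0)
qed

section \<open>The Stepanov polynomial of a subgroup\<close>

text \<open>Binomial expansion produces power sums of exponent i + 1, and these survive only at i =
  n(l + 1) - 1. Indices beyond \<open>N\<close> have binomial coefficient 0, so the truncated
  exponent of \<open>c\<close> does no harm there.\<close>

lemma sum_mult_binomial_power:
  fixes H :: "int set" and n :: nat
  assumes "n > 0" "finite H"
    and ps: "\<And>k. [(\<Sum>h\<in>H. h ^ k) = (if n dvd k then int n else 0)] (mod m)"
    and N: "N < n * r"
  shows "[(\<Sum>h\<in>H. h * (h + c) ^ N)
    = int n * (\<Sum>l<r. int (N choose (n * Suc l - 1)) * c ^ (N - (n * Suc l - 1)))] (mod m)"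
proof -
  let ?b = "\<lambda>i. int (N choose i) * c ^ (N - i)"
  have "(\<Sum>h\<in>H. h * (h + c) ^ N) = (\<Sum>h\<in>H. \<Sum>i\<le>N. ?b i * h ^ Suc i)"
    by (simp add: binomial_ring sum_distrib_left mult_ac)
  also have "\<dots> = (\<Sum>i\<le>N. ?b i * (\<Sum>h\<in>H. h ^ Suc i))"
    by (subst sum.swap) (simp add: sum_distrib_left)
  also have "[\<dots> = (\<Sum>i\<le>N. ?b i * (if n dvd Suc i then int n else 0))] (mod m)"
    by (intro cong_sum cong_scalar_left ps)
  also have "(\<Sum>i\<le>N. ?b i * (if n dvd Suc i then int n else 0))
     = (\<Sum>i<n * r. ?b i * (if n dvd Suc i then int n else 0))"
    by (rule sum.mono_neutral_left) (use N in auto)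
  also have "\<dots> = (\<Sum>i\<in>{i. i < n * r \<and> n dvd Suc i}. ?b i * int n)"
    by (rule sum.mono_neutral_cong_right) auto
  also have "\<dots> = (\<Sum>l<r. ?b (n * Suc l - 1) * int n)"
  proof (rule sum.reindex_bij_witness[of _ "\<lambda>l. n * Suc l - 1" "\<lambda>i. Suc i div n - 1"])
    fix i assume i: "i \<in> {i. i < n * r \<and> n dvd Suc i}"
    then obtain q where q: "Suc i = n * q" by auto
    with assms(1) have "q > 0" by (cases q) auto
    with q assms(1) have d: "Suc i div n - 1 = q - 1" "Suc (q - 1) = q"
      by (metis nonzero_mult_div_cancel_left not_gr_zero, simp)
    have "Suc i \<le> n * r" using i by simp
    hence "n * q \<le> n * r" by (simp only: q)
    hence "q \<le> r" using assms(1) mult_le_cancel1 by blast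
    with d \<open>q > 0\<close> show "Suc i div n - 1 \<in> {..<r}" by auto
    show bk: "n * Suc (Suc i div n - 1) - 1 = i"
      unfolding d q[symmetric] by simp
    show "?b (n * Suc (Suc i div n - 1) - 1) * int n = ?b i * int n"
      unfolding bk ..
  next
    fix l assume l: "l \<in> {..<r}"
    have S: "Suc (n * Suc l - 1) = n * Suc l" using assms(1) by simp
    show "Suc (n * Suc l - 1) div n - 1 = l"
      unfolding S using assms(1) by (metis diff_Suc_1 nonzero_mult_div_cancel_left not_gr_zero)
    have "n * Suc l \<le> n * r" using l by (intro mult_le_mono) auto
    thus "n * Suc l - 1 \<in> {i. i < n * r \<and> n dvd Suc i}"
      unfolding mem_Collect_eq Suc_le_eq[symmetric] S by auto
  qed
  also have "\<dots> = int n * (\<Sum>l<r. ?b (n * Suc l - 1))"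
    by (simp add: sum_distrib_left mult_ac)
  finally show ?thesis .
qed

text \<open>With r = 1 the only candidate index is n - 1, which exceeds \<open>N\<close> unless N =
  n - 1. This is the source of the vanishing order n - 1 of F - e.\<close>

lemma sum_mult_binomial_power_less:
  fixes H :: "int set" and n :: nat
  assumes "n > 0" "finite H"
    and ps: "\<And>k. [(\<Sum>h\<in>H. h ^ k) = (if n dvd k then int n else 0)] (mod m)"
    and N: "N < n"
  shows "[(\<Sum>h\<in>H. h * (h + c) ^ N) = (if N = n - 1 then int n else 0)] (mod m)"
  using sum_mult_binomial_power[of n H m N 1 c] assms by (auto simp: binomial_eq_0)

text \<open>The exponent n(n - 1) equals (p - 1)/2, so by Euler's criterion \<open>minus\<close> and
  \<open>plus\<close> are the values of chi at h - 1 and h + 1.\<close>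

lemma no_uniform_quadratic_shifts:
  fixes p n :: nat and H :: "int set" and e :: int
  assumes p: "prime p" and n: "odd n" "n > 3" and pn: "p = 2 * n * (n - 1) + 1"
    and H: "finite H" "1 \<in> H"
    and ps: "\<And>k. [(\<Sum>h\<in>H. h ^ k) = (if n dvd k then int n else 0)] (mod int p)"
    and e: "e = 1 \<or> e = -1"
    and minus: "\<And>h. h \<in> H \<Longrightarrow> h \<noteq> 1 \<Longrightarrow> [(h - 1) ^ (n * (n - 1)) = e] (mod int p)"
    and plus: "\<And>h. h \<in> H \<Longrightarrow> h \<noteq> 1 \<Longrightarrow> [(h + 1) ^ (n * (n - 1)) = 1] (mod int p)"
  shows False
proof -
  define D where "D = n * n - 1"
  \<comment> \<open>As n is odd, D is even and (-1)^(n l) = (-1)^l, so this is the coefficient of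
    x^(n l) in F; \<open>K\<close> below is the leading one.\<close>
  define w where "w l = (-1) ^ l * int (D choose (n * l))" for l
  define K where "K = w (n - 1)"
  \<comment> \<open>N = n - 2: the derivatives of orders 0, ..., N are controlled, and the top index
    of \<open>w\<close> is \<open>Suc N\<close>.\<close>
  obtain N where N: "n = Suc (Suc N)" "N \<ge> 2" 
  proof
    show "n = Suc (Suc (n - 2))" "n - 2 \<ge> 2" using n by auto
  qed
  have evN: "odd N" using n N by simp
  have D: "D = n * (n - 1) + (n - 1)" using N by (simp add: D_def)
  have small: "Suc n < p" "D < p" using N unfolding D pn by simp_all
  have cop: "coprime (int n) (int p)" by (rule coprime_prime_int) (use p small N in auto)
  have split_pow: "D - k = n * (n - 1) + (n - 1 - k)" if "k \<le> n - 1" for k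
    using that D by simp

  \<comment> \<open>Up to the falling factorial of D of length k, the left side is the k-th
    derivative of F at 1. The single point 1 suffices because F is a polynomial in x^n.\<close>
  have moment: "[(\<Sum>l\<le>Suc N. (-1) ^ l * int ((D - k) choose (D - n * l)))
      = (if k = 0 then e else 0)] (mod int p)" if k: "k \<le> N" for k
  proof -
    let ?S = "\<Sum>l\<le>Suc N. (-1) ^ l * int ((D - k) choose (D - n * l))"
    have "[(\<Sum>h\<in>H. h * (h + -1) ^ (D - k)) = (\<Sum>h\<in>H. e * (h * (h + -1) ^ (n - 1 - k)))] (mod int p)"
    proof (rule cong_sum)
      fix h assume h: "h \<in> H"
      show "[h * (h + -1) ^ (D - k) = e * (h * (h + -1) ^ (n - 1 - k))] (mod int p)"
      \<comment> \<open>At h = 1 the character value is 0 instead of e, but k \<le> n - 2 keeps both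
        exponents positive, so both sides vanish.\<close>
      proof (cases "h = 1")
        case True
        thus ?thesis using split_pow[of k] k N by (simp add: power_0_left)
      next
        case False
        have "h * (h + -1) ^ (D - k) = (h - 1) ^ (n * (n - 1)) * (h * (h + -1) ^ (n - 1 - k))"
        proof -
          have "D - k = n * (n - 1) + (n - 1 - k)" using k N by (intro split_pow) simp
          thus ?thesis by (simp only: power_add mult_ac) simp
        qed
        thus ?thesis using minus[OF h False] by (metis cong_scalar_right)
      qed
    qed
    also have "(\<Sum>h\<in>H. e * (h * (h + -1) ^ (n - 1 - k))) = e * (\<Sum>h\<in>H. h * (h + -1) ^ (n - 1 - k))"
      by (simp only: sum_distrib_left)
    also have "[\<dots> = e * (if n - 1 - k = n - 1 then int n else 0)] (mod int p)"
      by (intro cong_scalar_left sum_mult_binomial_power_less ps) (use N H in auto)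
    also have "e * (if n - 1 - k = n - 1 then int n else 0) = int n * (if k = 0 then e else 0)"
      using k N by auto
    finally have 1: "[(\<Sum>h\<in>H. h * (h + -1) ^ (D - k)) = int n * (if k = 0 then e else 0)] (mod int p)" .
    have "[(\<Sum>h\<in>H. h * (h + -1) ^ (D - k))
      = int n * (\<Sum>l<n. int ((D - k) choose (n * Suc l - 1)) * (-1) ^ (D - k - (n * Suc l - 1)))] (mod int p)"
      by (intro sum_mult_binomial_power ps) (use N H in \<open>auto simp: D_def\<close>)
    \<comment> \<open>Replacing l by n - 1 - l turns the lower index n(l + 1) - 1 into D - n l,
      which passes from exponents of h to exponents of x.\<close>
    also have "(\<Sum>l<n. int ((D - k) choose (n * Suc l - 1)) * (-1) ^ (D - k - (n * Suc l - 1)))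
       = (\<Sum>l<n. int ((D - k) choose (n * Suc (n - Suc l) - 1)) * (-1) ^ (D - k - (n * Suc (n - Suc l) - 1)))"
      by (rule sum.nat_diff_reindex[symmetric])
    also have "\<dots> = (\<Sum>l<n. (-1) ^ k * ((-1) ^ l * int ((D - k) choose (D - n * l))))"
    proof (rule sum.cong)
      fix l assume "l \<in> {..<n}"
      hence l: "l < n" by simp
      have nl: "n * Suc (n - Suc l) - 1 = D - n * l"
        using l by (simp add: D_def Suc_diff_Suc diff_mult_distrib2)
      have le: "n * l \<le> D" using l unfolding D 
        by (intro trans_le_add1 mult_le_mono2) simp
      show "int ((D - k) choose (n * Suc (n - Suc l) - 1)) * (-1) ^ (D - k - (n * Suc (n - Suc l) - 1))
         = (-1) ^ k * ((-1) ^ l * int ((D - k) choose (D - n * l)))"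
      proof (cases "k \<le> n * l")
        case True
        have "D - k - (D - n * l) = n * l - k" using True le by simp
        moreover have "(-1) ^ (n * l - k) = ((-1) ^ k * (-1) ^ l :: int)"
          using True n(1) by (simp add: minus_one_power_iff)
        ultimately show ?thesis unfolding nl by (simp add: mult_ac)
      next
        case False
        hence "(D - k) choose (D - n * l) = 0" using k N le small D by (intro binomial_eq_0) linarith
        thus ?thesis unfolding nl by simp
      qed
    qed simp
    also have "\<dots> = (-1) ^ k * ?S" using N by (simp only: sum_distrib_left lessThan_Suc_atMost)
    finally have "[int n * ((-1) ^ k * ?S) = int n * (if k = 0 then e else 0)] (mod int p)"
      using 1 cong_sym cong_trans by blast
    hence "[(-1) ^ k * ?S = (if k = 0 then e else 0)] (mod int p)"
      using cop cong_mult_lcancel by blast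
    hence "[(-1) ^ k * ((-1) ^ k * ?S) = (-1) ^ k * (if k = 0 then e else 0)] (mod int p)"
      by (rule cong_scalar_left)
    moreover have "(-1) ^ k * ((-1) ^ k * ?S) = ?S"
      by (simp only: mult.assoc[symmetric] minus_one_mult_self mult_1)
    ultimately show ?thesis by (simp split: if_splits)
  qed

  have nlD: "n * l \<le> D" if "l \<le> Suc N" for l
    using that N unfolding D by (intro trans_le_add1 mult_le_mono2) simp

  have fall: "[(\<Sum>l\<le>Suc N. w l * (\<Prod>i<k. int (n * l) - int i)) = 0] (mod int p)"
    if k: "1 \<le> k" "k \<le> N" for k
  proof -
    have kD: "k \<le> D" using k N unfolding D by linarith
    have "(\<Sum>l\<le>Suc N. w l * (\<Prod>i<k. int (n * l) - int i))
       = (\<Sum>l\<le>Suc N. (\<Prod>i<k. int D - int i) * ((-1) ^ l * int ((D - k) choose (D - n * l))))"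
    proof (rule sum.cong)
      fix l assume "l \<in> {..Suc N}"
      thus "w l * (\<Prod>i<k. int (n * l) - int i) = (\<Prod>i<k. int D - int i) * ((-1) ^ l * int ((D - k) choose (D - n * l)))"
        using choose_mult_falling[of "n * l" D k] nlD[of l] kD by (simp add: w_def mult_ac del: of_nat_mult)
    qed simp
    also have "\<dots> = (\<Prod>i<k. int D - int i) * (\<Sum>l\<le>Suc N. (-1) ^ l * int ((D - k) choose (D - n * l)))"
      by (simp only: sum_distrib_left)
    also have "[\<dots> = (\<Prod>i<k. int D - int i) * 0] (mod int p)"
      using moment[OF k(2)] k(1) by (intro cong_scalar_left) simp
    finally show ?thesis by simp
  qed

  \<comment> \<open>The identity F = e + K (x^n - 1)^(n - 1) read off at the positive powers of x^n;
    the sign is (-1)^m because n - 1 is even.\<close>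
  have wK: "[w m = (-1) ^ m * int (Suc N choose m) * K] (mod int p)" if m: "1 \<le> m" "m \<le> Suc N" for m
  proof (cases "m = Suc N")
    case True
    thus ?thesis using evN by (simp add: K_def N)
  next
    case False
    have "[w m = (-1) ^ (Suc N - m) * int (Suc N choose m) * w (Suc N)] (mod int p)"
      by (rule falling_moments_binomial[OF p, where c = n]) (use N small m False fall in auto)
    moreover have "(-1) ^ (Suc N - m) = ((-1) ^ m :: int)"
      using evN m by (simp add: minus_one_power_iff)
    ultimately show ?thesis by (simp add: K_def N)
  qed

  have split0: "(\<Sum>l\<le>M. f l) = f 0 + (\<Sum>l\<in>{1..M}. f l)" for M and f :: "nat \<Rightarrow> int"
    by (simp add: sum.atLeast_Suc_atMost atMost_atLeast0)

  \<comment> \<open>The case k = 0 of \<open>moment\<close> says F(1) = e. Here \<open>w 0\<close>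
    is 1, and the alternating binomial row without its first entry sums to -1.\<close>
  have K: "[K = 1 - e] (mod int p)"
  proof -
    have "(\<Sum>l\<le>Suc N. (-1) ^ l * int ((D - 0) choose (D - n * l))) = (\<Sum>l\<le>Suc N. w l)"
      using nlD by (intro sum.cong) (auto simp: w_def binomial_symmetric[symmetric])
    also have "\<dots> = 1 + (\<Sum>l\<in>{1..Suc N}. w l)"
      unfolding split0 by (simp add: w_def)
    finally have "[e = 1 + (\<Sum>l\<in>{1..Suc N}. w l)] (mod int p)"
      using moment[of 0] by (simp add: cong_sym_eq)
    also have "[1 + (\<Sum>l\<in>{1..Suc N}. w l)
        = 1 + (\<Sum>l\<in>{1..Suc N}. (-1) ^ l * int (Suc N choose l) * K)] (mod int p)"
      by (intro cong_add cong_refl cong_sum wK) auto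
    also have "(\<Sum>l\<in>{1..Suc N}. (-1) ^ l * int (Suc N choose l) * K) = - K"
    proof -
      have "(\<Sum>l\<le>Suc N. (-1) ^ l * int (Suc N choose l)) = 0"
        using choose_alternating_sum[of "Suc N", where 'a = int] by simp
      hence "(\<Sum>l\<in>{1..Suc N}. (-1) ^ l * int (Suc N choose l)) = -1"
        unfolding split0 by simp
      thus ?thesis by (simp only: sum_distrib_right[symmetric])
    qed
    finally have "[e + (K - e) = (1 + - K) + (K - e)] (mod int p)"
      by (rule cong_add) (rule cong_refl)
    thus ?thesis by simp
  qed

  text \<open>T = - n F'(-1) / D.\<close>

  define T where "T = (\<Sum>h\<in>H. h * (h + 1) ^ (D - 1))"
  define x2 where "x2 = (2 :: int) ^ (n * (n - 1))"
  \<comment> \<open>Only h = 1 can deviate from chi(h + 1) = 1, its factor being chi(2), written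
    \<open>x2\<close>. Once that factor is replaced by 1, the full sum has exponent N < n - 1 and
    vanishes.\<close>
  have T1: "[T = (x2 - 1) * 2 ^ N] (mod int p)"
  proof -
    have D1: "D - 1 = n * (n - 1) + N" using D N by simp
    have "T = (\<Sum>h\<in>H - {1}. h * (h + 1) ^ (D - 1)) + x2 * 2 ^ N"
      unfolding T_def D1 power_add x2_def sum.remove[OF H] by simp
    also have "[\<dots> = (\<Sum>h\<in>H - {1}. h * (h + 1) ^ N) + x2 * 2 ^ N] (mod int p)"
    proof (intro cong_add cong_refl cong_sum)
      fix h assume h: "h \<in> H - {1}"
      have "h * (h + 1) ^ (D - 1) = (h + 1) ^ (n * (n - 1)) * (h * (h + 1) ^ N)"
        unfolding D1 by (simp only: power_add mult_ac)
      also have "[\<dots> = 1 * (h * (h + 1) ^ N)] (mod int p)"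
        by (intro cong_scalar_right plus) (use h in auto)
      finally show "[h * (h + 1) ^ (D - 1) = h * (h + 1) ^ N] (mod int p)" by simp
    qed
    also have "(\<Sum>h\<in>H - {1}. h * (h + 1) ^ N) + x2 * 2 ^ N
        = (\<Sum>h\<in>H. h * (h + 1) ^ N) + (x2 - 1) * 2 ^ N"
      unfolding sum.remove[OF H] by (simp add: algebra_simps)
    also have "[\<dots> = 0 + (x2 - 1) * 2 ^ N] (mod int p)"
      using sum_mult_binomial_power_less[of n H "int p" N 1] N H ps
      by (intro cong_add cong_refl) auto
    finally show ?thesis by simp
  qed
  \<comment> \<open>The second evaluation goes through the coefficients: absorption plays the role
    of differentiation, \<open>wK\<close> inserts binomial coefficients, and the sum of l C(n - 1,
    l) is (n - 1) 2^(n - 2).\<close>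
  have T2: "[int D * T = int n ^ 2 * K * (int (n - 1) * 2 ^ N)] (mod int p)"
  proof -
    have "[T = int n * (\<Sum>l<n. int ((D - 1) choose (n * Suc l - 1)) * 1 ^ (D - 1 - (n * Suc l - 1)))] (mod int p)"
      unfolding T_def by (intro sum_mult_binomial_power ps) (use N H in \<open>auto simp: D_def\<close>)
    hence "[int D * T = int D * (int n * (\<Sum>l<n. int ((D - 1) choose (n * Suc l - 1)) * 1 ^ (D - 1 - (n * Suc l - 1))))] (mod int p)"
      by (rule cong_scalar_left)
    also have "int D * (int n * (\<Sum>l<n. int ((D - 1) choose (n * Suc l - 1)) * 1 ^ (D - 1 - (n * Suc l - 1))))
       = (\<Sum>l<n. int n * (int D * int ((D - 1) choose (n * Suc l - 1))))"
      by (simp add: sum_distrib_left mult_ac)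
    also have "\<dots> = (\<Sum>l<n. int n ^ 2 * (int (Suc l) * int (D choose (n * Suc l))))"
    proof (rule sum.cong)
      fix l
      have S: "Suc (n * Suc l - 1) = n * Suc l" using N by simp
      have "D * ((D - 1) choose (n * Suc l - 1)) = n * Suc l * (D choose (n * Suc l))"
        using binomial_absorption[of "n * Suc l - 1" D] unfolding S by simp
      hence "int D * int ((D - 1) choose (n * Suc l - 1)) = int n * int (Suc l) * int (D choose (n * Suc l))"
        by (metis of_nat_mult)
      thus "int n * (int D * int ((D - 1) choose (n * Suc l - 1))) = int n ^ 2 * (int (Suc l) * int (D choose (n * Suc l)))"
        by (simp only: power2_eq_square mult_ac)
    qed simp
    also have "\<dots> = int n ^ 2 * (\<Sum>l<n. int (Suc l) * int (D choose (n * Suc l)))"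
      by (simp only: sum_distrib_left)
    also have "(\<Sum>l<n. int (Suc l) * int (D choose (n * Suc l))) = (\<Sum>l<Suc N. int (Suc l) * int (D choose (n * Suc l)))"
    proof -
      have "D < n * n" using N by (simp add: D_def)
      hence "D choose (n * Suc (Suc N)) = 0" using N by (intro binomial_eq_0) simp
      thus ?thesis unfolding N(1) by (simp only: sum.lessThan_Suc)
    qed
    also have "\<dots> = (\<Sum>l\<in>{1..Suc N}. int l * ((-1) ^ l * w l))"
      by (simp add: sum.atLeast1_atMost_eq w_def flip: mult.assoc power_add)
    also have "[int n ^ 2 * (\<Sum>l\<in>{1..Suc N}. int l * ((-1) ^ l * w l))
        = int n ^ 2 * (\<Sum>l\<in>{1..Suc N}. int l * ((-1) ^ l * ((-1) ^ l * int (Suc N choose l) * K)))] (mod int p)"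
      by (intro cong_scalar_left cong_sum wK) auto
    also have "(\<Sum>l\<in>{1..Suc N}. int l * ((-1) ^ l * ((-1) ^ l * int (Suc N choose l) * K)))
       = (\<Sum>l\<in>{1..Suc N}. int l * int (Suc N choose l) * K)"
      by (intro sum.cong refl) (simp add: minus_one_power_iff)
    also have "\<dots> = (\<Sum>l\<in>{1..Suc N}. int (l * (Suc N choose l))) * K"
      by (simp only: sum_distrib_right of_nat_mult)
    also have "(\<Sum>l\<in>{1..Suc N}. int (l * (Suc N choose l))) = int (\<Sum>l\<le>Suc N. l * (Suc N choose l))"
      unfolding of_nat_sum split0 by (simp only: mult_zero_left of_nat_0 add_0)
    also have "\<dots> = int (n - 1) * 2 ^ N"
      unfolding choose_linear_sum using N by (simp add: algebra_simps)
    finally show ?thesis by (simp add: mult_ac)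
  qed

  \<comment> \<open>Both evaluations of D T are equated; since D = (n - 1)(n + 1), the unit (n - 1)
    2^N cancels.\<close>
  have rel: "[int (n + 1) * (x2 - 1) = int n ^ 2 * K] (mod int p)"
  proof -
    have "[int D * ((x2 - 1) * 2 ^ N) = int n ^ 2 * K * (int (n - 1) * 2 ^ N)] (mod int p)"
      using T2 T1 cong_scalar_left cong_sym cong_trans by blast
    moreover have "int D = int (n - 1) * int (n + 1)"
      unfolding D using N by (simp add: algebra_simps)
    ultimately have "[(int (n - 1) * 2 ^ N) * (int (n + 1) * (x2 - 1))
       = (int (n - 1) * 2 ^ N) * (int n ^ 2 * K)] (mod int p)"
      by (simp only: mult_ac)
    moreover have "coprime (int (n - 1) * 2 ^ N) (int p)"
      using coprime_prime_int[OF p, of "n - 1"] coprime_prime_int[OF p, of 2] small N by simp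
    ultimately show ?thesis using cong_mult_lcancel by blast
  qed

  have cop2: "coprime (2 :: int) (int p)" using coprime_prime_int[OF p, of 2] small N by simp
  have "[x2 = 1] (mod int p) \<or> [x2 = -1] (mod int p)"
  proof -
    have "x2 * x2 = 2 ^ (p - 1)"
      by (simp add: x2_def pn mult_2 flip: power_add) (simp add: algebra_simps)
    moreover have "\<not> int p dvd 2" using cop2 small N by (auto dest: zdvd_imp_le)
    ultimately have "[x2 * x2 = 1] (mod int p)" using fermat_int[OF p] by simp
    thus ?thesis by (rule square_eq_one_mod_prime[OF p])
  qed
  thus False
  proof
    assume "[x2 = 1] (mod int p)"
    hence "[int n ^ 2 * K = int (n + 1) * 0] (mod int p)"
      using rel by (metis cong_diff_iff_cong_0 cong_scalar_left cong_sym cong_trans)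
    hence "[int n ^ 2 * K = int n ^ 2 * 0] (mod int p)" by simp
    hence "[K = 0] (mod int p)"
      using cop cong_mult_lcancel[of "int n ^ 2" "int p" K 0] by simp
    hence "int p dvd int (D choose (n * Suc N))"
      using evN by (simp add: K_def w_def N cong_0_iff)
    hence "p dvd (D choose (n * Suc N))" by simp
    moreover have "(D choose (n * Suc N)) dvd fact D"
      using binomial_fact_lemma[OF nlD[of "Suc N"]] by (metis dvd_triv_right order_refl)
    ultimately have "p dvd fact D" by (rule dvd_trans)
    thus False using p small by (simp add: prime_dvd_fact_iff)
  next
    assume "[x2 = -1] (mod int p)"
    hence "[int (n + 1) * (x2 - 1) = int (n + 1) * (-1 - 1)] (mod int p)"
      by (intro cong_scalar_left cong_diff cong_refl)
    moreover have "[int n ^ 2 * K = int n ^ 2 * (1 - e)] (mod int p)"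
      by (intro cong_scalar_left K)
    ultimately have c: "[int (n + 1) * (-1 - 1) = int n ^ 2 * (1 - e)] (mod int p)"
      using rel cong_sym cong_trans by blast
    from e show False
    proof
      assume "e = 1"
      with c have "int p dvd int (n + 1) * (-1 - 1) - int n ^ 2 * (1 - 1)"
        by (simp only: cong_iff_dvd_diff)
      also have "int (n + 1) * (-1 - 1) - int n ^ 2 * (1 - 1) = - (int (n + 1) * 2)" by simp
      finally have "int p dvd int (n + 1) * 2" by (simp only: dvd_minus_iff)
      hence "p dvd n + 1"
        using cop2 by (metis coprime_commute coprime_dvd_mult_left_iff int_dvd_int_iff)
      thus False using small N by (auto dest: dvd_imp_le)
    next
      assume "e = -1"
      with c have "int p dvd int (n + 1) * (-1 - 1) - int n ^ 2 * (1 - (-1))"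
        by (simp only: cong_iff_dvd_diff)
      also have "int (n + 1) * (-1 - 1) - int n ^ 2 * (1 - (-1)) = - (2 * (int n ^ 2 + int (n + 1)))"
        by simp
      finally have "int p dvd 2 * (int n ^ 2 + int (n + 1))" by (simp only: dvd_minus_iff)
      hence "int p dvd int n ^ 2 + int (n + 1)"
        using cop2 by (metis coprime_commute coprime_dvd_mult_right_iff)
      hence "p dvd n ^ 2 + (n + 1)" by (metis int_dvd_int_iff of_nat_add of_nat_power)
      hence "p \<le> n ^ 2 + (n + 1)" by (rule dvd_imp_le) simp
      \<comment> \<open>The bound reads n^2 \<le> 3 n, with n = N + 2. Equality occurs at n = 3,
        where p = 13 = n^2 + n + 1.\<close>
      hence "N * N + N \<le> 2" unfolding pn N(1) by (simp add: power2_eq_square)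
      moreover have "2 * 2 \<le> N * N" using N(2) by (intro mult_le_mono)
      ultimately show False by simp
    qed
  qed
qed

section \<open>Cosets as difference sets\<close>

theorem theorem1:
  fixes p :: nat
  assumes "prime p" and "p > 13"
  shows "\<not> (\<exists>H g. subgroup H (mult_of (residue_ring (int p))) \<and>
              g \<in> carrier (mult_of (residue_ring (int p))) \<and>
              diff_exact (residue_ring (int p))
                (g <#\<^bsub>mult_of (residue_ring (int p))\<^esub> H) (QR_set (int p)))"
proof (rule notI, elim exE conjE)
  fix H g
  assume subgroup: "subgroup H (mult_of (residue_ring (int p)))"
    and g: "g \<in> carrier (mult_of (residue_ring (int p)))"
    and ex: "diff_exact (residue_ring (int p))
                (g <#\<^bsub>mult_of (residue_ring (int p))\<^esub> H) (QR_set (int p))"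
  have carrier: "carrier (mult_of (residue_ring (int p))) = {1..<int p}"
    by (auto simp: residue_ring_def)
  interpret residue_subgroup p H
  proof
    show "prime p" by fact
    show "H \<subseteq> {1..<int p}" using subgroup.subset[OF subgroup] carrier by simp
    show "1 \<in> H" using subgroup.one_closed[OF subgroup] by (simp add: residue_ring_def)
    show "x * y mod int p \<in> H" if "x \<in> H" "y \<in> H" for x y
      using subgroup.m_closed[OF subgroup that] by (simp add: residue_ring_def)
  qed
  define A where "A = (\<lambda>h. g * h mod int p) ` H"
  have "g <#\<^bsub>mult_of (residue_ring (int p))\<^esub> H = A"
    by (auto simp: l_coset_def A_def residue_ring_def)
  with ex have ex: "diff_exact (residue_ring (int p)) A (QR_set (int p))" by simp
  note ex' = ex[unfolded diff_exact_def residue_ring_minus[OF prime]]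
  have "p \<noteq> 2" using assms(2) by simp
  hence odd: "odd p" using prime primes_dvd_imp_eq two_is_prime_nat by blast
  have g_ndvd: "\<not> int p dvd g" using g carrier range_not_dvd by blast
  have inj: "inj_on (\<lambda>h. g * h mod int p) H"
  proof (rule inj_onI)
    fix x y assume *: "x \<in> H" "y \<in> H" "g * x mod int p = g * y mod int p"
    show "x = y"
      by (rule cong_cancel_range[OF prime, of g]) (use * g_ndvd range in \<open>auto simp: cong_def\<close>)
  qed
  have Asub: "A \<subseteq> {0..<int p}" using prime_gt_0_nat[OF prime] by (auto simp: A_def)
  have "0 \<notin> QR_set (int p)" by (simp add: QR_set_eq)
  from diff_exact_card[OF prime Asub this ex]
  have card: "card H * (card H - 1) = (p - 1) div 2"
    using inj by (simp add: card_QR_set[OF prime odd] A_def card_image)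
  define n where "n = card H"
  have half: "n * (n - 1) = (p - 1) div 2" using card by (simp add: n_def)
  have pn: "p = 2 * n * (n - 1) + 1"
  proof -
    have "2 * (n * (n - 1)) = p - 1" unfolding half using odd by simp
    thus ?thesis using prime_gt_0_nat[OF prime] by (simp only: mult.assoc)
  qed
  have n3: "n > 3"
  proof (rule ccontr)
    assume "\<not> n > 3"
    hence "n * (n - 1) \<le> 3 * 2" by (intro mult_le_mono) auto
    thus False using assms(2) by (simp add: pn mult.assoc)
  qed

  have diff_QR: "g * (h - k) mod int p \<in> QR_set (int p)" if "h \<in> H" "k \<in> H" "h \<noteq> k" for h k
  proof -
    have "g * h mod int p \<noteq> g * k mod int p" using inj that by (auto dest: inj_onD)
    hence "(g * h mod int p - g * k mod int p) mod int p \<in> QR_set (int p)"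
      using ex' that by (auto simp: A_def)
    thus ?thesis by (simp add: mod_diff_eq right_diff_distrib)
  qed

  \<comment> \<open>Multiplication by \<open>g\<close> carries both pairs into \<open>A\<close>.
    Since h and k differ, their common difference is then a quadratic residue, whose representation
    is unique.\<close>
  have diff_unique: "h = h'"
    if "h \<in> H" "k \<in> H" "h' \<in> H" "k' \<in> H" "h \<noteq> k" and eq: "[h - k = h' - k'] (mod int p)" for h k h' k'
  proof -
    let ?m = "\<lambda>h. g * h mod int p"
    have *: "(?m x - ?m y) mod int p = g * (x - y) mod int p" for x y
      by (simp add: mod_diff_eq right_diff_distrib)
    have "[g * (h - k) = g * (h' - k')] (mod int p)" using eq by (rule cong_scalar_left)
    hence eq': "g * (h' - k') mod int p = g * (h - k) mod int p" by (simp add: cong_def)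
    have "\<exists>!ab. fst ab \<in> A \<and> snd ab \<in> A \<and> (fst ab - snd ab) mod int p = g * (h - k) mod int p"
      using diff_QR[of h k] that ex' by blast
    moreover have "fst (?m h, ?m k) \<in> A \<and> snd (?m h, ?m k) \<in> A \<and>
        (fst (?m h, ?m k) - snd (?m h, ?m k)) mod int p = g * (h - k) mod int p"
      using that by (simp only: fst_conv snd_conv *) (simp add: A_def)
    moreover have "fst (?m h', ?m k') \<in> A \<and> snd (?m h', ?m k') \<in> A \<and>
        (fst (?m h', ?m k') - snd (?m h', ?m k')) mod int p = g * (h - k) mod int p"
      using that by (simp only: fst_conv snd_conv * eq') (simp add: A_def)
    ultimately have "(?m h, ?m k) = (?m h', ?m k')" by blast
    thus ?thesis using inj that by (auto dest: inj_onD)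
  qed

  have "odd n"
  proof
    assume "even n"
    hence u: "int p - 1 \<in> H" unfolding n_def by (rule minus_one_mem)
    \<comment> \<open>The residue of \<open>(int p - 1) * h\<close> is -h. Comparing h - 1 with (-1)
      - (-h), uniqueness forces h = -1.\<close>
    have "H \<subseteq> {1, int p - 1}"
    proof
      fix h assume h: "h \<in> H"
      show "h \<in> {1, int p - 1}"
      proof (cases "h = 1")
        case False
        have "[(int p - 1) - (int p - 1) * h mod int p = (int p - 1) - (int p - 1) * h] (mod int p)"
          by (simp add: cong_def mod_diff_right_eq)
        also have "(int p - 1) - (int p - 1) * h = h - 1 + int p * (1 - h)"
          by (simp add: algebra_simps)
        also have "[\<dots> = h - 1] (mod int p)" by (simp add: cong_def)
        finally have "[h - 1 = (int p - 1) - (int p - 1) * h mod int p] (mod int p)"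
          by (rule cong_sym)
        with diff_unique[OF h one u mult[OF u h] False] show ?thesis by simp
      qed simp
    qed
    hence "n \<le> card {1, int p - 1}" unfolding n_def by (intro card_mono) auto
    also have "\<dots> \<le> 2" by (simp add: card_insert_if)
    finally show False using n3 by simp
  qed

  \<comment> \<open>This is e = chi(g), a square root of 1 by Fermat's theorem.\<close>
  obtain e where e: "e = 1 \<or> e = -1" "[g ^ (n * (n - 1)) = e] (mod int p)"
  proof -
    have "g ^ (n * (n - 1)) * g ^ (n * (n - 1)) = g ^ (p - 1)"
      by (simp add: pn mult_2 distrib_right flip: power_add)
    hence "[g ^ (n * (n - 1)) * g ^ (n * (n - 1)) = 1] (mod int p)"
      using fermat_int[OF prime g_ndvd] by simp
    thus ?thesis using square_eq_one_mod_prime[OF prime] that by blast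
  qed
  hence ee: "e * e = 1" by auto

  \<comment> \<open>As \<open>g * (h - 1)\<close> is a quadratic residue, chi(g) chi(h - 1) = 1;
    multiplying by e, its own inverse, isolates chi(h - 1).\<close>
  have minus: "[(h - 1) ^ (n * (n - 1)) = e] (mod int p)" if h: "h \<in> H" "h \<noteq> 1" for h
  proof -
    have "[(g * (h - 1)) ^ (n * (n - 1)) = 1] (mod int p)"
      unfolding half by (intro QR_set_power prime odd diff_QR h one)
    hence "[e * (g ^ (n * (n - 1)) * (h - 1) ^ (n * (n - 1))) = e * 1] (mod int p)"
      unfolding power_mult_distrib by (rule cong_scalar_left)
    moreover have "[e * (g ^ (n * (n - 1)) * (h - 1) ^ (n * (n - 1))) = e * (e * (h - 1) ^ (n * (n - 1)))] (mod int p)"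
      by (intro cong_scalar_left cong_scalar_right e)
    moreover have "e * (e * (h - 1) ^ (n * (n - 1))) = (h - 1) ^ (n * (n - 1))"
      by (simp add: ee flip: mult.assoc)
    ultimately show ?thesis by (metis cong_sym cong_trans mult.right_neutral)
  qed

  have plus: "[(h + 1) ^ (n * (n - 1)) = 1] (mod int p)" if h: "h \<in> H" "h \<noteq> 1" for h
  proof -
    define q where "q = h * h mod int p"
    have q: "q \<in> H" using mult h by (simp add: q_def)
    have q1: "q \<noteq> 1"
    proof
      assume "q = 1"
      hence "[h * h = 1] (mod int p)" using prime_gt_1_nat[OF prime] by (simp add: q_def cong_def)
      \<comment> \<open>Odd order lets h be recovered from its square: h^n = (h^2)^r h, so h^2 = 1
        would give h = 1.\<close>
      obtain r where r: "n = 2 * r + 1" using \<open>odd n\<close> by (auto elim: oddE)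
      have "h ^ n = (h * h) ^ r * h"
        by (simp add: r power_mult power2_eq_square)
      also have "[\<dots> = 1 ^ r * h] (mod int p)"
        by (intro cong_scalar_right cong_pow) fact
      finally have "[h = 1] (mod int p)"
        using power_card[OF h(1)] unfolding n_def[symmetric] by (metis cong_sym cong_trans mult_1 power_one)
      hence "h = 1" by (rule cong_int_range_eq) (rule range(1)[OF h(1)] range(1)[OF one])+
      thus False using h by simp
    qed
    \<comment> \<open>Applying \<open>minus\<close> to the residue of h^2 gives e = chi(h - 1) chi(h
      + 1) = e chi(h + 1).\<close>
    have "[e = (q - 1) ^ (n * (n - 1))] (mod int p)"
      using minus[OF q q1] by (rule cong_sym)
    also have "[(q - 1) ^ (n * (n - 1)) = (h * h - 1) ^ (n * (n - 1))] (mod int p)"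
      by (intro cong_pow cong_diff cong_refl) (simp add: q_def cong_def)
    also have "(h * h - 1) ^ (n * (n - 1)) = (h - 1) ^ (n * (n - 1)) * (h + 1) ^ (n * (n - 1))"
      by (simp add: algebra_simps flip: power_mult_distrib)
    also have "[\<dots> = e * (h + 1) ^ (n * (n - 1))] (mod int p)"
      by (intro cong_scalar_right minus h)
    finally have "[e * (e * (h + 1) ^ (n * (n - 1))) = e * e] (mod int p)"
      by (intro cong_scalar_left) (rule cong_sym)
    thus ?thesis by (simp add: ee flip: mult.assoc)
  qed

  show False
    by (rule no_uniform_quadratic_shifts[OF prime \<open>odd n\<close> n3 pn fin one
          power_sum[folded n_def] e(1) minus plus])
qed

end
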